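(* Let the thickness $h>0$ be so small that $h|\kappa_1|<\frac12$ and $h|\kappa_2|<\frac12$ on $\omega$, where $\kappa_1,\kappa_2$ are the principal curvatures of the surface $y_0(\omega)$, and let the constitutive coefficients satisfy $\mu>0$, $\mu_{\rm c}>0$, $2\lambda+\mu>0$, $b_1>0$, $b_2>0$, $b_3>0$. Then the energy density $$W(\mathcal{E}_{m,s},\mathcal{K}_{e,s})=W_{\mathrm{memb}}(\mathcal{E}_{m,s})+W_{\mathrm{memb,bend}}(\mathcal{E}_{m,s},\mathcal{K}_{e,s})+W_{\mathrm{bend,curv}}(\mathcal{K}_{e,s})$$ (including terms up to order $O(h^5)$) is uniformly convex in $(\mathcal{E}_{m,s},\mathcal{K}_{e,s})$, i.e., there exists a constant $a_1^+>0$ such that $$D^2W(\mathcal{E}_{m,s},\mathcal{K}_{e,s}).[(H_1,H_2),(H_1,H_2)]\ \ge\ a_1^+\big(\lVert H_1\rVert^2+\lVert H_2\rVert^2\big)\qquad\forall\,H_1,H_2\in\mathbb{R}^{3\times3}.$$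
   Context: Notation: $\langle X,Y\rangle=\mathrm{tr}(XY^T)$ and $\lVert X\rVert^2=\langle X,X\rangle$ (Frobenius); $\mathrm{sym}\,X=\frac12(X+X^T)$, $\mathrm{skew}\,X=\frac12(X-X^T)$, $\mathrm{dev}\,X=X-\frac13\mathrm{tr}(X)\,\mathbb{1}_3$ for $X\in\mathbb{R}^{3\times3}$, with $\mathbb 1_3$ the identity. For a $3\times 2$ matrix $M$ and a vector $v$, $(M|v)$ is the $3\times3$ matrix obtained by appending the column $v$. Geometry: $\omega\subset\mathbb{R}^2$ is a bounded domain with Lipschitz boundary, $h>0$ is the constant thickness, $y_0:\omega\to\mathbb{R}^3$ is a $C^2$ map parametrizing the midsurface of the curved reference configuration, $n_0=\frac{\partial_{x_1}y_0\times\partial_{x_2}y_0}{\lVert\partial_{x_1}y_0\times\partial_{x_2}y_0\rVert}$, and $\Theta(x_1,x_2,x_3)=y_0(x_1,x_2)+x_3\,n_0(x_1,x_2)$ is assumed to be a $C^1$-diffeomorphism from $\Omega_h=\omega\times(-\frac h2,\frac h2)$ onto its image. Then $\nabla_x\Theta(0)=(\nabla y_0|n_0)$ (value at $x_3=0$). Put $\mathrm{I}_{y_0}=(\nabla y_0)^T\nabla y_0$, $\mathrm{II}_{y_0}=-(\nabla y_0)^T\nabla n_0$, $\mathrm{L}_{y_0}=\mathrm{I}_{y_0}^{-1}\mathrm{II}_{y_0}$, $\mathrm{K}=\det\mathrm{L}_{y_0}$ (Gauss curvature), $\mathrm{H}=\frac12\mathrm{tr}\,\mathrm{L}_{y_0}$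 (mean curvature); $\kappa_1,\kappa_2$ are the eigenvalues of $\mathrm{L}_{y_0}$. Define $$\mathrm{B}_{y_0}=-(\nabla n_0|0)[\nabla_x\Theta(0)]^{-1},\qquad \mathrm{C}_{y_0}=\det(\nabla_x\Theta(0))\,[\nabla_x\Theta(0)]^{-T}\begin{pmatrix}0&1&0\\-1&0&0\\0&0&0\end{pmatrix}[\nabla_x\Theta(0)]^{-1}.$$ Energy: at each point of $\omega$, $W$ is regarded as a function of two matrix variables $\mathcal E=\mathcal{E}_{m,s}$ (elastic shell strain tensor) and $\mathcal K=\mathcal{K}_{e,s}$ (elastic shell bending-curvature tensor) in $\mathbb{R}^{3\times 3}$, and $D^2W$ is its second derivative with respect to these variables: $$W_{\mathrm{memb}}(\mathcal E)=\Big(h+\mathrm K\tfrac{h^3}{12}\Big)W_{\mathrm{shell}}(\mathcal E),$$ $$\begin{aligned}W_{\mathrm{memb,bend}}(\mathcal E,\mathcal K)=&\Big(\tfrac{h^3}{12}-\mathrm K\tfrac{h^5}{80}\Big)W_{\mathrm{shell}}(\mathcal E\mathrm B_{y_0}+\mathrm C_{y_0}\mathcal K)-\tfrac{h^3}{3}\mathrm H\,\mathcal W_{\mathrm{shell}}(\mathcal E,\mathcal E\mathrm B_{y_0}+\mathrm C_{y_0}\mathcal K)\\&+\tfrac{h^3}{6}\mathcal W_{\mathrm{shell}}(\mathcal E,(\mathcal E\mathrm B_{y_0}+\mathrm C_{y_0}\mathcal K)\mathrm B_{y_0})+\tfrac{h^5}{80}W_{\mathrm{mp}}((\mathcal E\mathrm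 B_{y_0}+\mathrm C_{y_0}\mathcal K)\mathrm B_{y_0}),\end{aligned}$$ $$W_{\mathrm{bend,curv}}(\mathcal K)=\Big(h-\mathrm K\tfrac{h^3}{12}\Big)W_{\mathrm{curv}}(\mathcal K)+\Big(\tfrac{h^3}{12}-\mathrm K\tfrac{h^5}{80}\Big)W_{\mathrm{curv}}(\mathcal K\mathrm B_{y_0})+\tfrac{h^5}{80}W_{\mathrm{curv}}(\mathcal K\mathrm B_{y_0}^2),$$ where $$W_{\mathrm{shell}}(S)=\mu\lVert\mathrm{sym}\,S\rVert^2+\mu_{\rm c}\lVert\mathrm{skew}\,S\rVert^2+\tfrac{\lambda\mu}{\lambda+2\mu}[\mathrm{tr}\,S]^2,$$ $$\mathcal W_{\mathrm{shell}}(S,T)=\mu\langle\mathrm{sym}\,S,\mathrm{sym}\,T\rangle+\mu_{\rm c}\langle\mathrm{skew}\,S,\mathrm{skew}\,T\rangle+\tfrac{\lambda\mu}{\lambda+2\mu}\mathrm{tr}(S)\,\mathrm{tr}(T),$$ $$W_{\mathrm{mp}}(S)=\mu\lVert\mathrm{sym}\,S\rVert^2+\mu_{\rm c}\lVert\mathrm{skew}\,S\rVert^2+\tfrac{\lambda}{2}[\mathrm{tr}\,S]^2,$$ $$W_{\mathrm{curv}}(S)=\mu L_{\rm c}^2\big(b_1\lVert\mathrm{dev}\,\mathrm{sym}\,S\rVert^2+b_2\lVert\mathrm{skew}\,S\rVert^2+b_3[\mathrm{tr}\,S]^2\big).$$ Here $\mu,\lambda,\mu_{\rm c},b_1,b_2,b_3$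 are real constitutive coefficients and $L_{\rm c}>0$ is a fixed internal length. *)

theory Defs
  imports "HOL-Analysis.Analysis"
begin

unbundle cross3_syntax


section \<open>Matrices\<close>

text \<open>The library's inner product and norm on \<^typ>\<open>real^'n^'m\<close> are the Frobenius ones.\<close>

lemma inner_eq_trace: "X \<bullet> Y = trace (X ** transpose Y)" for X Y :: "real^'n^'m"
  by (simp add: inner_vec_def trace_def matrix_matrix_mult_def transpose_def)

definition sym_part :: "real^'n^'n \<Rightarrow> real^'n^'n"
  where "sym_part X = (1/2) *\<^sub>R (X + transpose X)"

definition skew_part :: "real^'n^'n \<Rightarrow> real^'n^'n"
  where "skew_part X = (1/2) *\<^sub>R (X - transpose X)"

definition dev_part :: "real^3^3 \<Rightarrow> real^3^3"
  where "dev_part X = X - (trace X / 3) *\<^sub>R mat 1"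

definition append_column :: "real^2^3 \<Rightarrow> real^3 \<Rightarrow> real^3^3"
  where "append_column M v = (\<chi> i. vector [M $ i $ 1, M $ i $ 2, v $ i])"

definition is_eigenvalue :: "real^'n^'n \<Rightarrow> real \<Rightarrow> bool"
  where "is_eigenvalue A k \<longleftrightarrow> (\<exists>v. v \<noteq> 0 \<and> A *v v = k *\<^sub>R v)"


section \<open>Regularity of maps and domains\<close>

definition C1_on :: "'a::real_normed_vector set \<Rightarrow> ('a \<Rightarrow> 'b::real_normed_vector) \<Rightarrow> bool"
  where "C1_on S f \<longleftrightarrow>
    (\<exists>f' :: 'a \<Rightarrow> 'a \<Rightarrow>\<^sub>L 'b.
       (\<forall>x\<in>S. (f has_derivative blinfun_apply (f' x)) (at x)) \<and> continuous_on S f')"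

definition C2_on :: "'a::real_normed_vector set \<Rightarrow> ('a \<Rightarrow> 'b::real_normed_vector) \<Rightarrow> bool"
  where "C2_on S f \<longleftrightarrow>
    (\<exists>f' :: 'a \<Rightarrow> 'a \<Rightarrow>\<^sub>L 'b.
       (\<forall>x\<in>S. (f has_derivative blinfun_apply (f' x)) (at x)) \<and> C1_on S f')"

text \<open>Both are meant for open \<open>S\<close>, where \<open>at x\<close> agrees with \<open>at x within S\<close>.\<close>

definition C1_diffeomorphism_on ::
    "'a::real_normed_vector set \<Rightarrow> ('a \<Rightarrow> 'b::real_normed_vector) \<Rightarrow> bool"
  where "C1_diffeomorphism_on S f \<longleftrightarrow>
    open S \<and> open (f ` S) \<and> inj_on f S \<and> C1_on S f \<and> C1_on (f ` S) (inv_into S f)"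

text \<open>
  Near each boundary point the set is, in suitable orthonormal coordinates with last axis \<open>e\<close>,
  the part strictly above the graph of a Lipschitz function \<open>g\<close> of the remaining coordinates,
  i.e. of the component orthogonal to \<open>e\<close>.
\<close>

definition lipschitz_boundary :: "'a::euclidean_space set \<Rightarrow> bool"
  where "lipschitz_boundary S \<longleftrightarrow>
    (\<forall>p\<in>frontier S. \<exists>r>0. \<exists>e. norm e = 1 \<and>
       (\<exists>g :: 'a \<Rightarrow> real. (\<exists>L. L-lipschitz_on {z. z \<bullet> e = 0} g) \<and>
          S \<inter> ball p r = {x \<in> ball p r. x \<bullet> e > g (x - (x \<bullet> e) *\<^sub>R e)}))"


section \<open>Geometry of the reference midsurface\<close>

definition unit_normal :: "(real^2 \<Rightarrow> real^3) \<Rightarrow> real^2 \<Rightarrow> real^3"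
  where "unit_normal y0 x =
    (let c = column 1 (jacobian y0 (at x)) \<times> column 2 (jacobian y0 (at x))
     in c /\<^sub>R norm c)"

definition proj2 :: "real^3 \<Rightarrow> real^2"
  where "proj2 X = vector [X $ 1, X $ 2]"

definition shell_map :: "(real^2 \<Rightarrow> real^3) \<Rightarrow> real^3 \<Rightarrow> real^3"
  where "shell_map y0 X = y0 (proj2 X) + X $ 3 *\<^sub>R unit_normal y0 (proj2 X)"

definition shell_domain :: "real \<Rightarrow> (real^2) set \<Rightarrow> (real^3) set"
  where "shell_domain h \<omega> = {X. proj2 X \<in> \<omega> \<and> - h / 2 < X $ 3 \<and> X $ 3 < h / 2}"

definition grad_Theta0 :: "(real^2 \<Rightarrow> real^3) \<Rightarrow> real^2 \<Rightarrow> real^3^3"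
  where "grad_Theta0 y0 x = jacobian (shell_map y0) (at (vector [x $ 1, x $ 2, 0]))"

lemma grad_Theta0_eq:
  assumes y: "y0 differentiable (at x)" and n: "unit_normal y0 differentiable (at x)"
  shows "grad_Theta0 y0 x = append_column (jacobian y0 (at x)) (unit_normal y0 x)"
proof -
  let ?p = "vector [x $ 1, x $ 2, 0] :: real^3"
  have px: "proj2 ?p = x"
    by (simp add: proj2_def vec_eq_iff forall_2)
  have lp: "linear proj2"
    by (rule linearI) (simp_all add: proj2_def vec_eq_iff forall_2)
  have dp: "(proj2 has_derivative proj2) (at ?p)"
    by (rule linear_imp_has_derivative[OF lp])
  have dy: "(y0 has_derivative (*v) (jacobian y0 (at x))) (at (proj2 ?p))"
    using y by (simp add: px jacobian_works)
  have dn: "(unit_normal y0 has_derivative (*v) (jacobian (unit_normal y0) (at x))) (at (proj2 ?p))"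
    using n by (simp add: px jacobian_works)
  note dy' = has_derivative_compose[OF dp dy] and dn' = has_derivative_compose[OF dp dn]
  have d3: "((\<lambda>X::real^3. X $ 3) has_derivative (\<lambda>X. X $ 3)) (at ?p)"
    by (rule bounded_linear_imp_has_derivative) (rule bounded_linear_vec_nth)
  have "(shell_map y0 has_derivative
      (\<lambda>X. jacobian y0 (at x) *v proj2 X + X $ 3 *\<^sub>R unit_normal y0 x)) (at ?p)"
    using has_derivative_add[OF dy' has_derivative_scaleR[OF d3 dn']]
    by (simp add: shell_map_def[abs_def] px)
  then have "frechet_derivative (shell_map y0) (at ?p) =
      (\<lambda>X. jacobian y0 (at x) *v proj2 X + X $ 3 *\<^sub>R unit_normal y0 x)"
    by (rule frechet_derivative_at[symmetric])
  then show ?thesis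
    by (simp add: grad_Theta0_def jacobian_def[of "shell_map y0"] append_column_def matrix_def
        vec_eq_iff forall_3 proj2_def matrix_vector_mult_def sum_2 axis_def)
qed

definition first_form :: "(real^2 \<Rightarrow> real^3) \<Rightarrow> real^2 \<Rightarrow> real^2^2"
  where "first_form y0 x = transpose (jacobian y0 (at x)) ** jacobian y0 (at x)"

definition second_form :: "(real^2 \<Rightarrow> real^3) \<Rightarrow> real^2 \<Rightarrow> real^2^2"
  where "second_form y0 x =
    - (transpose (jacobian y0 (at x)) ** jacobian (unit_normal y0) (at x))"

definition weingarten :: "(real^2 \<Rightarrow> real^3) \<Rightarrow> real^2 \<Rightarrow> real^2^2"
  where "weingarten y0 x = matrix_inv (first_form y0 x) ** second_form y0 x"

definition gauss_curvature :: "(real^2 \<Rightarrow> real^3) \<Rightarrow> real^2 \<Rightarrow> real"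
  where "gauss_curvature y0 x = det (weingarten y0 x)"

definition mean_curvature :: "(real^2 \<Rightarrow> real^3) \<Rightarrow> real^2 \<Rightarrow> real"
  where "mean_curvature y0 x = trace (weingarten y0 x) / 2"

definition principal_curvature :: "(real^2 \<Rightarrow> real^3) \<Rightarrow> real^2 \<Rightarrow> real \<Rightarrow> bool"
  where "principal_curvature y0 x k \<longleftrightarrow> is_eigenvalue (weingarten y0 x) k"

definition B_tensor :: "(real^2 \<Rightarrow> real^3) \<Rightarrow> real^2 \<Rightarrow> real^3^3"
  where "B_tensor y0 x =
    - (append_column (jacobian (unit_normal y0) (at x)) 0 ** matrix_inv (grad_Theta0 y0 x))"

definition C_tensor :: "(real^2 \<Rightarrow> real^3) \<Rightarrow> real^2 \<Rightarrow> real^3^3"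
  where "C_tensor y0 x =
    det (grad_Theta0 y0 x) *\<^sub>R
      (transpose (matrix_inv (grad_Theta0 y0 x))
        ** vector [vector [0, 1, 0], vector [-1, 0, 0], vector [0, 0, 0]]
        ** matrix_inv (grad_Theta0 y0 x))"


section \<open>The shell energy density\<close>

definition W_shell :: "real \<Rightarrow> real \<Rightarrow> real \<Rightarrow> real^3^3 \<Rightarrow> real"
  where "W_shell \<mu> \<mu>c lam S =
    \<mu> * (norm (sym_part S))\<^sup>2 + \<mu>c * (norm (skew_part S))\<^sup>2
    + lam * \<mu> / (lam + 2 * \<mu>) * (trace S)\<^sup>2"

definition W_shell_bilin :: "real \<Rightarrow> real \<Rightarrow> real \<Rightarrow> real^3^3 \<Rightarrow> real^3^3 \<Rightarrow> real"
  where "W_shell_bilin \<mu> \<mu>c lam S T =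
    \<mu> * (sym_part S \<bullet> sym_part T) + \<mu>c * (skew_part S \<bullet> skew_part T)
    + lam * \<mu> / (lam + 2 * \<mu>) * trace S * trace T"

definition W_mp :: "real \<Rightarrow> real \<Rightarrow> real \<Rightarrow> real^3^3 \<Rightarrow> real"
  where "W_mp \<mu> \<mu>c lam S =
    \<mu> * (norm (sym_part S))\<^sup>2 + \<mu>c * (norm (skew_part S))\<^sup>2 + lam / 2 * (trace S)\<^sup>2"

definition W_curv :: "real \<Rightarrow> real \<Rightarrow> real \<Rightarrow> real \<Rightarrow> real \<Rightarrow> real^3^3 \<Rightarrow> real"
  where "W_curv \<mu> Lc b1 b2 b3 S =
    \<mu> * Lc\<^sup>2 * (b1 * (norm (dev_part (sym_part S)))\<^sup>2 + b2 * (norm (skew_part S))\<^sup>2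
                + b3 * (trace S)\<^sup>2)"

definition W_memb ::
    "real \<Rightarrow> real \<Rightarrow> real \<Rightarrow> real \<Rightarrow> (real^2 \<Rightarrow> real^3) \<Rightarrow> real^2 \<Rightarrow> real^3^3 \<Rightarrow> real"
  where "W_memb h \<mu> \<mu>c lam y0 x E =
    (h + gauss_curvature y0 x * (h^3 / 12)) * W_shell \<mu> \<mu>c lam E"

definition W_memb_bend ::
    "real \<Rightarrow> real \<Rightarrow> real \<Rightarrow> real \<Rightarrow> (real^2 \<Rightarrow> real^3) \<Rightarrow> real^2
      \<Rightarrow> real^3^3 \<Rightarrow> real^3^3 \<Rightarrow> real"
  where "W_memb_bend h \<mu> \<mu>c lam y0 x E K =
    (let B = B_tensor y0 x; X = E ** B + C_tensor y0 x ** K in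
       (h^3 / 12 - gauss_curvature y0 x * (h^5 / 80)) * W_shell \<mu> \<mu>c lam X
       - h^3 / 3 * mean_curvature y0 x * W_shell_bilin \<mu> \<mu>c lam E X
       + h^3 / 6 * W_shell_bilin \<mu> \<mu>c lam E (X ** B)
       + h^5 / 80 * W_mp \<mu> \<mu>c lam (X ** B))"

definition W_bend_curv ::
    "real \<Rightarrow> real \<Rightarrow> real \<Rightarrow> real \<Rightarrow> real \<Rightarrow> real \<Rightarrow> (real^2 \<Rightarrow> real^3) \<Rightarrow> real^2
      \<Rightarrow> real^3^3 \<Rightarrow> real"
  where "W_bend_curv h \<mu> Lc b1 b2 b3 y0 x K =
    (let B = B_tensor y0 x in
       (h - gauss_curvature y0 x * (h^3 / 12)) * W_curv \<mu> Lc b1 b2 b3 K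
       + (h^3 / 12 - gauss_curvature y0 x * (h^5 / 80)) * W_curv \<mu> Lc b1 b2 b3 (K ** B)
       + h^5 / 80 * W_curv \<mu> Lc b1 b2 b3 (K ** (B ** B)))"

definition W_total ::
    "real \<Rightarrow> real \<Rightarrow> real \<Rightarrow> real \<Rightarrow> real \<Rightarrow> real \<Rightarrow> real \<Rightarrow> real
      \<Rightarrow> (real^2 \<Rightarrow> real^3) \<Rightarrow> real^2 \<Rightarrow> (real^3^3) \<times> (real^3^3) \<Rightarrow> real"
  where "W_total h \<mu> \<mu>c lam Lc b1 b2 b3 y0 x = (\<lambda>(E, K).
    W_memb h \<mu> \<mu>c lam y0 x E + W_memb_bend h \<mu> \<mu>c lam y0 x E K
    + W_bend_curv h \<mu> Lc b1 b2 b3 y0 x K)"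

text \<open>\<open>second_derivative f z u v\<close> is the second Frechet derivative \<open>D\<^sup>2f(z).[u, v]\<close>.\<close>

definition second_derivative ::
    "('a::real_normed_vector \<Rightarrow> 'b::real_normed_vector) \<Rightarrow> 'a \<Rightarrow> 'a \<Rightarrow> 'a \<Rightarrow> 'b"
  where "second_derivative f z u v =
    frechet_derivative (\<lambda>w. frechet_derivative f (at w) u) (at z) v"

end

theory Submission
  imports Defs
begin

text \<open>
  The density is a quadratic form, so its second derivative in direction \<open>(H1, H2)\<close> is twice its
  value there. The derivative of the diffeomorphism \<open>\<Theta>\<close> along the third axis at \<open>x\<^sub>3 = 0\<close> is the unit
  normal, which therefore does not degenerate to its junk value \<open>0\<close>, and the first fundamental
  form is positive definite. As the second one is symmetric, the Weingarten map has real
  eigenvalues, and its determinant and half trace are at most \<open>1 / (4 h\<^sup>2)\<close> and \<open>1 / (2 h)\<close> in absolute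
  value. With \<open>W_mp \<ge> W_shell\<close>, the membrane part is bounded below by a combination of inner products
  of \<open>E\<close>, \<open>X = E B + C K\<close> and \<open>X B\<close>, in which completing squares absorbs the mixed terms at the cost
  of a fixed fraction of the term in \<open>E\<close>. In the bending part only the term \<open>W_curv K\<close> is needed.
  Neither estimate involves the size of \<open>B\<close> or \<open>C\<close>, hence the constant is uniform on \<open>\<omega>\<close>.
\<close>

section \<open>Quadratic forms\<close>

text \<open>\<open>\<beta>\<close> may be non-symmetric, so that mixed terms
  \<open>f z \<bullet> g z\<close> with two different linear maps are covered without
  symmetrizing.\<close>

definition quadratic_form :: "('a::real_normed_vector \<Rightarrow> real) \<Rightarrow> bool"
  where "quadratic_form q \<longleftrightarrow> (\<exists>\<beta>. bounded_bilinear \<beta> \<and> q = (\<lambda>z. \<beta> z z))"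

text \<open>By the product rule the first derivative is linear in the base point, so differentiating
  again along \<open>u\<close> gives \<open>\<beta> u u\<close> twice, whatever \<open>z\<close>
  is.\<close>

lemma second_derivative_quadratic_form:
  assumes "quadratic_form q"
  shows "second_derivative q z u u = 2 * q u"
proof -
  obtain \<beta> where \<beta>: "bounded_bilinear \<beta>" and q: "q = (\<lambda>z. \<beta> z z)"
    using assms by (auto simp: quadratic_form_def)
  interpret bounded_bilinear \<beta> by fact
  have "(q has_derivative (\<lambda>v. \<beta> w v + \<beta> v w)) (at w)" for w
    unfolding q by (rule FDERIV) (rule has_derivative_ident)+
  then have 1: "frechet_derivative q (at w) = (\<lambda>v. \<beta> w v + \<beta> v w)" for w
    by (rule frechet_derivative_at[symmetric])
  have "((\<lambda>w. \<beta> w u + \<beta> u w) has_derivative (\<lambda>v. \<beta> v u + \<beta> u v)) (at z)"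
    by (intro bounded_linear_imp_has_derivative bounded_linear_add bounded_linear_left bounded_linear_right)
  then have 2: "frechet_derivative (\<lambda>w. \<beta> w u + \<beta> u w) (at z) = (\<lambda>v. \<beta> v u + \<beta> u v)"
    by (rule frechet_derivative_at[symmetric])
  show ?thesis
    unfolding second_derivative_def 1 2 by (simp add: q)
qed

lemma quadratic_form_inner:
  fixes f g :: "'a::real_normed_vector \<Rightarrow> 'b::real_inner"
  assumes "bounded_linear f" "bounded_linear g"
  shows "quadratic_form (\<lambda>z. f z \<bullet> g z)"
  unfolding quadratic_form_def
  by (intro exI[of _ "\<lambda>z w. f z \<bullet> g w"] conjI refl bounded_bilinear.comp[OF bounded_bilinear_inner] assms)

lemma quadratic_form_mult:
  assumes "bounded_linear f" "bounded_linear g"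
  shows "quadratic_form (\<lambda>z. f z * g z)"
  using quadratic_form_inner[OF assms] by simp

lemma quadratic_form_cmult:
  assumes "quadratic_form q"
  shows "quadratic_form (\<lambda>z. c * q z)"
proof -
  obtain \<beta> where \<beta>: "bounded_bilinear \<beta>" and q: "q = (\<lambda>z. \<beta> z z)"
    using assms by (auto simp: quadratic_form_def)
  interpret bounded_bilinear \<beta> by fact
  have "bounded_bilinear (\<lambda>z w. \<beta> (c *\<^sub>R z) w)"
    using comp1[OF bounded_linear_scaleR_right] .
  then show ?thesis
    unfolding quadratic_form_def q by (auto simp: scaleR_left)
qed

lemma quadratic_form_add:
  assumes "quadratic_form p" "quadratic_form q"
  shows "quadratic_form (\<lambda>z. p z + q z)"
proof -
  obtain \<alpha> \<beta> where \<alpha>: "bounded_bilinear \<alpha>" "p = (\<lambda>z. \<alpha> z z)" and \<beta>: "bounded_bilinear \<beta>" "q = (\<lambda>z. \<beta> z z)"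
    using assms by (auto simp: quadratic_form_def)
  interpret a: bounded_bilinear \<alpha> by fact
  interpret b: bounded_bilinear \<beta> by fact
  obtain Ka where Ka: "\<And>x y. norm (\<alpha> x y) \<le> norm x * norm y * Ka" using a.bounded by blast
  obtain Kb where Kb: "\<And>x y. norm (\<beta> x y) \<le> norm x * norm y * Kb" using b.bounded by blast
  have "bounded_bilinear (\<lambda>z w. \<alpha> z w + \<beta> z w)"
  proof
    show "\<exists>K. \<forall>x y. norm (\<alpha> x y + \<beta> x y) \<le> norm x * norm y * K"
    proof (intro exI allI)
      fix x y show "norm (\<alpha> x y + \<beta> x y) \<le> norm x * norm y * (Ka + Kb)"
        using norm_triangle_mono[OF Ka Kb] by (simp add: distrib_left)
    qed
  qed (simp_all add: a.add_left a.add_right b.add_left b.add_right a.scaleR_left b.scaleR_left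
         a.scaleR_right b.scaleR_right distrib_left)
  then show ?thesis
    unfolding quadratic_form_def \<alpha> \<beta> by auto
qed

section \<open>Coercivity of the energy\<close>

lemma bounded_linear_trace: "bounded_linear (trace :: real^'n^'n \<Rightarrow> real)"
  by (intro linear_linear[THEN iffD2] linearI)
    (simp_all add: trace_def sum.distrib sum_distrib_left)

lemma bounded_linear_transpose: "bounded_linear (transpose :: real^'n^'m \<Rightarrow> real^'m^'n)"
  by (intro linear_linear[THEN iffD2] linearI) (simp_all add: transpose_def vec_eq_iff)

lemma bounded_linear_sym_part: "bounded_linear sym_part"
  unfolding sym_part_def
  by (intro bounded_linear_scaleR_right[THEN bounded_linear_compose] bounded_linear_add
      bounded_linear_ident bounded_linear_transpose)

lemma bounded_linear_skew_part: "bounded_linear skew_part"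
  unfolding skew_part_def
  by (intro bounded_linear_scaleR_right[THEN bounded_linear_compose] bounded_linear_sub
      bounded_linear_ident bounded_linear_transpose)

lemma bounded_linear_dev_part: "bounded_linear dev_part"
  unfolding dev_part_def divide_inverse
  by (intro bounded_linear_sub bounded_linear_ident
      bounded_linear_scaleR_left[THEN bounded_linear_compose]
      bounded_linear_mult_left[THEN bounded_linear_compose] bounded_linear_trace)

lemma bounded_linear_matrix_mult_left: "bounded_linear (\<lambda>X::real^'n^'m. X ** (B::real^'k^'n))"
  by (intro linear_linear[THEN iffD2] linearI)
    (simp_all add: matrix_matrix_mult_def vec_eq_iff distrib_right sum.distrib sum_distrib_left mult.assoc)

lemma bounded_linear_matrix_mult_right: "bounded_linear (\<lambda>X::real^'n^'m. (C::real^'m^'k) ** X)"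
  by (intro linear_linear[THEN iffD2] linearI)
    (simp_all add: matrix_matrix_mult_def distrib_left sum.distrib vec_eq_iff sum_distrib_left mult.left_commute)

section \<open>Orthogonal splitting into deviatoric symmetric, skew and trace parts\<close>

lemma matrix_trace_simps:
  fixes X :: "real^3^3"
  shows "trace (transpose X) = trace X" "trace (sym_part X) = trace X"
    "trace (dev_part X) = 0" "trace (mat 1 :: real^3^3) = 3"
proof -
  show a: "trace (transpose X) = trace X" by (simp add: trace_def transpose_def)
  show d: "trace (mat 1 :: real^3^3) = 3" by (simp add: trace_def mat_def)
  show "trace (sym_part X) = trace X"
    using a by (simp add: sym_part_def linear_simps[OF bounded_linear_trace])
  show "trace (dev_part X) = 0"
    using d by (simp add: dev_part_def linear_simps[OF bounded_linear_trace])
qed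

lemma inner_mat_1: "(X::real^'n^'n) \<bullet> mat 1 = trace X" "mat 1 \<bullet> X = trace X"
proof -
  show 1: "X \<bullet> mat 1 = trace X"
    by (simp only: inner_eq_trace transpose_mat matrix_mul_rid)
  show "mat 1 \<bullet> X = trace X"
    using 1 by (simp only: inner_commute)
qed

lemma sym_part_eq_dev_part: "sym_part X = dev_part (sym_part X) + (trace X / 3) *\<^sub>R mat 1"
  by (simp only: dev_part_def matrix_trace_simps diff_add_cancel)

text \<open>Trace-free matrices are orthogonal to the identity, so the cross terms vanish; the
  identity has squared norm 3, which turns the factor 1/9 into 1/3.\<close>

lemma inner_sym_part:
  "sym_part S \<bullet> sym_part T = dev_part (sym_part S) \<bullet> dev_part (sym_part T) + trace S * trace T / 3"
proof -
  have "sym_part S \<bullet> sym_part T = (dev_part (sym_part S) + (trace S / 3) *\<^sub>R mat 1)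
      \<bullet> (dev_part (sym_part T) + (trace T / 3) *\<^sub>R mat 1)"
    by (rule arg_cong2[OF sym_part_eq_dev_part sym_part_eq_dev_part])
  also have "\<dots> = dev_part (sym_part S) \<bullet> dev_part (sym_part T) + trace S * trace T / 3"
    by (simp add: inner_add_left inner_add_right inner_mat_1 matrix_trace_simps linear_simps[OF bounded_linear_trace])
  finally show ?thesis .
qed

lemma norm_matrix_decomp:
  fixes S :: "real^3^3"
  shows "(norm S)\<^sup>2 = (norm (dev_part (sym_part S)))\<^sup>2 + (norm (skew_part S))\<^sup>2 + (trace S)\<^sup>2 / 3"
proof -
  have t: "transpose S \<bullet> transpose S = S \<bullet> S"
    by (simp add: inner_vec_def transpose_def) (rule sum.swap)
  have "S \<bullet> S = sym_part S \<bullet> sym_part S + skew_part S \<bullet> skew_part S"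
    by (simp add: sym_part_def skew_part_def inner_add_left inner_add_right inner_diff_left
        inner_diff_right t inner_commute[of "transpose S" S] field_simps)
  then show ?thesis
    unfolding power2_norm_eq_inner by (simp add: inner_sym_part power2_eq_square)
qed

text \<open>Splitting off the trace part diagonalizes the form: it becomes a weighted sum of inner
  products of components, so an inequality between inner products can be applied to each component
  separately.\<close>

lemma W_shell_bilin_decomp:
  "W_shell_bilin \<mu> \<mu>c lam S T = \<mu> * (dev_part (sym_part S) \<bullet> dev_part (sym_part T))
    + \<mu>c * (skew_part S \<bullet> skew_part T) + (\<mu> / 3 + lam * \<mu> / (lam + 2 * \<mu>)) * (trace S * trace T)"
  by (simp add: W_shell_bilin_def inner_sym_part algebra_simps)

lemma W_shell_eq_bilin: "W_shell \<mu> \<mu>c lam S = W_shell_bilin \<mu> \<mu>c lam S S"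
  unfolding W_shell_bilin_def W_shell_def power2_norm_eq_inner by (simp add: power2_eq_square)

text \<open>The two forms differ only in the coefficient of the squared trace, by
  \<open>lam\<^sup>2 / (2 * (lam + 2 * \<mu>))\<close>.\<close>

lemma W_mp_ge_W_shell:
  assumes "lam + 2 * \<mu> > 0"
  shows "W_shell \<mu> \<mu>c lam S \<le> W_mp \<mu> \<mu>c lam S"
proof -
  have "lam * \<mu> / (lam + 2 * \<mu>) \<le> lam / 2"
    using assms zero_le_square[of lam] by (simp add: field_simps)
  then show ?thesis
    unfolding W_shell_def W_mp_def by (intro add_left_mono mult_right_mono) auto
qed

text \<open>This is the weight of the trace component in \<open>W_shell_bilin_decomp\<close>; its
  sign is where \<open>2 * lam + \<mu> > 0\<close> enters.\<close>

lemma shell_trace_coefficient_pos: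
  fixes \<mu> lam :: real
  assumes "\<mu> > 0" "2 * lam + \<mu> > 0"
  shows "\<mu> / 3 + lam * \<mu> / (lam + 2 * \<mu>) > 0"
proof -
  have p: "lam + 2 * \<mu> > 0" using assms by simp
  have "\<mu> / 3 + lam * \<mu> / (lam + 2 * \<mu>) = (2 * \<mu> / 3) * ((2 * lam + \<mu>) / (lam + 2 * \<mu>))"
    using p by (simp add: field_simps)
  then show ?thesis using assms p by simp
qed

text \<open>Stated in an arbitrary inner product space, since it serves both for matrix components
  and for real traces. The vectors \<open>e\<close>, \<open>x\<close>, \<open>z\<close> stand for
  the same component of \<open>E\<close>, \<open>X\<close> and \<open>X ** B\<close>.\<close>

lemma thickness_inequality:
  fixes e x z :: "'a::real_inner" and h K H :: real
  assumes h: "h > 0" and K: "\<bar>K\<bar> * h\<^sup>2 \<le> 1/4" and H: "\<bar>H\<bar> * h \<le> 1/2"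
  shows "h / 4 * (e \<bullet> e) \<le> (h + K * (h^3 / 12)) * (e \<bullet> e) + (h^3 / 12 - K * (h^5 / 80)) * (x \<bullet> x)
    - h^3 / 3 * H * (e \<bullet> x) + h^3 / 6 * (e \<bullet> z) + h^5 / 80 * (z \<bullet> z)"
proof -
  \<comment> \<open>Absorbing the powers of \<open>h\<close> into the variables makes the inequality
    dimensionless, up to one overall factor \<open>h\<close>.\<close>
  define k m where "k = K * h\<^sup>2" and "m = H * h"
  define x' z' where "x' = h *\<^sub>R x" and "z' = h\<^sup>2 *\<^sub>R z"
  have k: "\<bar>k\<bar> \<le> 1/4" and m: "\<bar>m\<bar> \<le> 1/2"
    using K H h by (simp_all add: k_def m_def abs_mult)
  \<comment> \<open>The factor 20/3 makes the cross term of this square, divided by 80, equal to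
    1/6, so the square of \<open>z'\<close> is used up completely at the cost of 5/9 of the square
    of \<open>e\<close>.\<close>
  have "0 \<le> (z' + (20/3) *\<^sub>R e) \<bullet> (z' + (20/3) *\<^sub>R e)" by simp
  then have Z: "- (5/9) * (e \<bullet> e) \<le> 1/80 * (z' \<bullet> z') + 1/6 * (e \<bullet> z')"
    by (simp add: inner_add_left inner_add_right inner_commute[of z' e] field_simps)
  \<comment> \<open>The factor 10/9 is chosen so that, after multiplication by at most 1/6, the
    square of \<open>x'\<close> carries 3/40, which is below the available
    \<open>1/12 - k/80\<close>.\<close>
  have "0 \<le> (x' - (10/9) *\<^sub>R e) \<bullet> (x' - (10/9) *\<^sub>R e)" "0 \<le> (x' + (10/9) *\<^sub>R e) \<bullet> (x' + (10/9) *\<^sub>R e)" by simp_all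
  then have X0: "\<bar>e \<bullet> x'\<bar> \<le> 5/9 * (e \<bullet> e) + 9/20 * (x' \<bullet> x')"
    by (simp add: inner_add_left inner_add_right inner_diff_left inner_diff_right inner_commute[of x' e] field_simps)
  have "m * (e \<bullet> x') \<le> \<bar>m\<bar> * \<bar>e \<bullet> x'\<bar>" by (metis abs_ge_self abs_mult)
  also have "\<dots> \<le> 1/2 * (5/9 * (e \<bullet> e) + 9/20 * (x' \<bullet> x'))"
    using m X0 by (intro mult_mono) auto
  finally have X: "m / 3 * (e \<bullet> x') \<le> 5/54 * (e \<bullet> e) + 3/40 * (x' \<bullet> x')" by simp
  have XX: "3/40 * (x' \<bullet> x') \<le> (1/12 - k/80) * (x' \<bullet> x')"
    using k by (intro mult_right_mono) auto
  have EE: "47/48 * (e \<bullet> e) \<le> (1 + k/12) * (e \<bullet> e)"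
    using k by (intro mult_right_mono) auto
  have "1/4 * (e \<bullet> e) \<le> (1 + k/12) * (e \<bullet> e) + (1/12 - k/80) * (x' \<bullet> x') - m/3 * (e \<bullet> x')
      + 1/6 * (e \<bullet> z') + 1/80 * (z' \<bullet> z')"
    \<comment> \<open>The budget for the square of \<open>e\<close> is 47/48 - 5/9 - 5/54 = 143/432,
      which exceeds 1/4.\<close>
    using Z X XX EE inner_ge_zero[of e] by linarith
  then have "h * (1/4 * (e \<bullet> e)) \<le> h * ((1 + k/12) * (e \<bullet> e) + (1/12 - k/80) * (x' \<bullet> x') - m/3 * (e \<bullet> x')
      + 1/6 * (e \<bullet> z') + 1/80 * (z' \<bullet> z'))"
    using h by (intro mult_left_mono) auto
  then show ?thesis
    by (simp add: k_def m_def x'_def z'_def algebra_simps power2_eq_square power3_eq_cube eval_nat_numeral)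
qed

lemma membrane_energy_ge:
  assumes h: "h > 0" and K: "\<bar>gauss_curvature y0 x\<bar> * h\<^sup>2 \<le> 1/4" and H: "\<bar>mean_curvature y0 x\<bar> * h \<le> 1/2"
    and \<mu>: "\<mu> > 0" "\<mu>c > 0" "2 * lam + \<mu> > 0"
  shows "h / 4 * W_shell \<mu> \<mu>c lam E \<le> W_memb h \<mu> \<mu>c lam y0 x E + W_memb_bend h \<mu> \<mu>c lam y0 x E K'"
proof -
  define B where "B = B_tensor y0 x"
  define X where "X = E ** B + C_tensor y0 x ** K'"
  define G M where "G = gauss_curvature y0 x" and "M = mean_curvature y0 x"
  define T where "T u v w = (h + G * (h^3 / 12)) * (u \<bullet> u) + (h^3 / 12 - G * (h^5 / 80)) * (v \<bullet> v)
    - h^3 / 3 * M * (u \<bullet> v) + h^3 / 6 * (u \<bullet> w) + h^5 / 80 * (w \<bullet> w)" for u v w :: "real^3^3"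
  \<comment> \<open>The same expression as \<open>T\<close> for real arguments, whose inner product
    is multiplication.\<close>
  define Tr where "Tr u v w = (h + G * (h^3 / 12)) * (u * u) + (h^3 / 12 - G * (h^5 / 80)) * (v * v)
    - h^3 / 3 * M * (u * v) + h^3 / 6 * (u * w) + h^5 / 80 * (w * w)" for u v w :: real
  define c where "c = \<mu> / 3 + lam * \<mu> / (lam + 2 * \<mu>)"
  have p: "lam + 2 * \<mu> > 0" using \<mu> by simp
  have c: "c > 0" using shell_trace_coefficient_pos[OF \<mu>(1,3)] by (simp add: c_def)
  have T: "h / 4 * (u \<bullet> u) \<le> T u v w" for u v w
    unfolding T_def using thickness_inequality[OF h] K H G_def M_def by blast
  have Tr: "h / 4 * (u * u) \<le> Tr u v w" for u v w
    unfolding Tr_def using thickness_inequality[OF h, of G M u v w] K H by (simp add: G_def M_def)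
  have mp: "h^5 / 80 * W_shell \<mu> \<mu>c lam (X ** B) \<le> h^5 / 80 * W_mp \<mu> \<mu>c lam (X ** B)"
    using h p by (intro mult_left_mono W_mp_ge_W_shell) auto
  have "h / 4 * W_shell \<mu> \<mu>c lam E = \<mu> * (h / 4 * (dev_part (sym_part E) \<bullet> dev_part (sym_part E)))
      + \<mu>c * (h / 4 * (skew_part E \<bullet> skew_part E)) + c * (h / 4 * (trace E * trace E))"
    unfolding W_shell_eq_bilin W_shell_bilin_decomp c_def[symmetric] by (simp add: algebra_simps)
  also have "\<dots> \<le> \<mu> * T (dev_part (sym_part E)) (dev_part (sym_part X)) (dev_part (sym_part (X ** B)))
      + \<mu>c * T (skew_part E) (skew_part X) (skew_part (X ** B)) + c * Tr (trace E) (trace X) (trace (X ** B))"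
    using \<mu> c by (intro add_mono mult_left_mono T Tr) auto
  also have "\<dots> = (h + G * (h^3 / 12)) * W_shell \<mu> \<mu>c lam E
     + (h^3 / 12 - G * (h^5 / 80)) * W_shell \<mu> \<mu>c lam X
       - h^3 / 3 * M * W_shell_bilin \<mu> \<mu>c lam E X
       + h^3 / 6 * W_shell_bilin \<mu> \<mu>c lam E (X ** B)
       + h^5 / 80 * W_shell \<mu> \<mu>c lam (X ** B)"
    unfolding W_shell_eq_bilin W_shell_bilin_decomp c_def[symmetric] T_def Tr_def by algebra
  finally show ?thesis
    using mp unfolding W_memb_def W_memb_bend_def Let_def B_def[symmetric] X_def[symmetric]
      G_def[symmetric] M_def[symmetric]
    by linarith
qed

text \<open>The factor 3 compensates the 1/3 with which the squared trace enters the Frobenius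
  norm.\<close>

lemma weighted_decomp_ge:
  fixes S :: "real^3^3"
  shows "min p (min q (3 * r)) * (norm S)\<^sup>2
    \<le> p * (norm (dev_part (sym_part S)))\<^sup>2 + q * (norm (skew_part S))\<^sup>2 + r * (trace S)\<^sup>2"
proof -
  let ?m = "min p (min q (3 * r))"
  have "?m * (norm (dev_part (sym_part S)))\<^sup>2 \<le> p * (norm (dev_part (sym_part S)))\<^sup>2"
    "?m * (norm (skew_part S))\<^sup>2 \<le> q * (norm (skew_part S))\<^sup>2"
    "?m * ((trace S)\<^sup>2 / 3) \<le> 3 * r * ((trace S)\<^sup>2 / 3)"
    by (intro mult_right_mono; simp)+
  then show ?thesis
    unfolding norm_matrix_decomp[of S] distrib_left by simp
qed

lemma W_shell_coercive:
  assumes "\<mu> > 0" "\<mu>c > 0" "2 * lam + \<mu> > 0"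
  obtains a where "a > 0" "\<And>S. a * (norm S)\<^sup>2 \<le> W_shell \<mu> \<mu>c lam S"
proof -
  define c where "c = \<mu> / 3 + lam * \<mu> / (lam + 2 * \<mu>)"
  have c: "c > 0" using shell_trace_coefficient_pos[OF assms(1,3)] by (simp add: c_def)
  show ?thesis
  proof
    show "min \<mu> (min \<mu>c (3 * c)) > 0" using assms c by simp
    show "min \<mu> (min \<mu>c (3 * c)) * (norm S)\<^sup>2 \<le> W_shell \<mu> \<mu>c lam S" for S
      using weighted_decomp_ge[of \<mu> \<mu>c c S]
      unfolding W_shell_eq_bilin W_shell_bilin_decomp c_def[symmetric]
      unfolding power2_norm_eq_inner by (simp add: power2_eq_square)
  qed
qed

lemma W_curv_coercive:
  assumes "\<mu> > 0" "b1 > 0" "b2 > 0" "b3 > 0" "Lc > 0"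
  obtains a where "a > 0" "\<And>S. a * (norm S)\<^sup>2 \<le> W_curv \<mu> Lc b1 b2 b3 S"
proof
  show "\<mu> * Lc\<^sup>2 * min b1 (min b2 (3 * b3)) > 0" using assms by simp
  show "\<mu> * Lc\<^sup>2 * min b1 (min b2 (3 * b3)) * (norm S)\<^sup>2 \<le> W_curv \<mu> Lc b1 b2 b3 S" for S
    unfolding W_curv_def mult.assoc[of "\<mu> * Lc\<^sup>2"]
    using assms by (intro mult_left_mono weighted_decomp_ge) auto
qed

lemma bending_energy_ge:
  assumes h: "h > 0" and K: "\<bar>gauss_curvature y0 x\<bar> * h\<^sup>2 \<le> 1/4"
    and W: "\<And>S. W_curv \<mu> Lc b1 b2 b3 S \<ge> 0"
  shows "h / 2 * W_curv \<mu> Lc b1 b2 b3 S \<le> W_bend_curv h \<mu> Lc b1 b2 b3 y0 x S"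
proof -
  define G where "G = gauss_curvature y0 x"
  have k: "\<bar>G * h\<^sup>2\<bar> \<le> 1/4" using K by (simp add: G_def abs_mult)
  have "h * (1/2) \<le> h * (1 - G * h\<^sup>2 / 12)"
    using h k by (intro mult_left_mono) auto
  then have 1: "h / 2 \<le> h - G * (h^3 / 12)"
    by (simp add: algebra_simps power2_eq_square power3_eq_cube)
  have "0 \<le> h^3 * (1/12 - G * h\<^sup>2 / 80)"
    using h k by (intro mult_nonneg_nonneg) auto
  then have 2: "0 \<le> h^3 / 12 - G * (h^5 / 80)"
    by (simp add: algebra_simps flip: power_add)
  show ?thesis
    unfolding W_bend_curv_def Let_def G_def[symmetric]
    using mult_right_mono[OF 1 W[of S]] mult_nonneg_nonneg[OF 2 W] h
      mult_nonneg_nonneg[OF _ W, of "h^5/80"]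
    by (smt (verit) zero_le_power divide_nonneg_pos)
qed

section \<open>The energy density as a quadratic form\<close>

lemma quadratic_form_W_shell_bilin:
  assumes "bounded_linear f" "bounded_linear g"
  shows "quadratic_form (\<lambda>z. W_shell_bilin \<mu> \<mu>c lam (f z) (g z))"
  unfolding W_shell_bilin_def mult.assoc
  by (intro quadratic_form_add quadratic_form_cmult quadratic_form_inner quadratic_form_mult
      bounded_linear_compose[OF bounded_linear_sym_part] bounded_linear_compose[OF bounded_linear_skew_part]
      bounded_linear_compose[OF bounded_linear_trace] assms)

lemma quadratic_form_W_mp:
  assumes "bounded_linear f"
  shows "quadratic_form (\<lambda>z. W_mp \<mu> \<mu>c lam (f z))"
  unfolding W_mp_def power2_norm_eq_inner power2_eq_square[of "trace _"]
  by (intro quadratic_form_add quadratic_form_cmult quadratic_form_inner quadratic_form_mult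
      bounded_linear_compose[OF bounded_linear_sym_part] bounded_linear_compose[OF bounded_linear_skew_part]
      bounded_linear_compose[OF bounded_linear_trace] assms)

lemma quadratic_form_W_curv:
  assumes "bounded_linear f"
  shows "quadratic_form (\<lambda>z. W_curv \<mu> Lc b1 b2 b3 (f z))"
  unfolding W_curv_def power2_norm_eq_inner power2_eq_square[of "trace _"]
  by (intro quadratic_form_add quadratic_form_cmult quadratic_form_inner quadratic_form_mult
      bounded_linear_compose[OF bounded_linear_dev_part]
      bounded_linear_compose[OF bounded_linear_sym_part] bounded_linear_compose[OF bounded_linear_skew_part]
      bounded_linear_compose[OF bounded_linear_trace] assms)

lemma quadratic_form_W_total: "quadratic_form (W_total h \<mu> \<mu>c lam Lc b1 b2 b3 y0 x)"
proof -
  define B C where "B = B_tensor y0 x" and "C = C_tensor y0 x"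
  define X where "X z = fst z ** B + C ** snd z" for z :: "(real^3^3) \<times> (real^3^3)"
  note right = bounded_linear_compose[OF bounded_linear_matrix_mult_left]
  have X: "bounded_linear X"
    unfolding X_def
    by (intro bounded_linear_add right bounded_linear_fst bounded_linear_snd
        bounded_linear_compose[OF bounded_linear_matrix_mult_right])
  \<comment> \<open>The closure rules cover sums and scalar multiples, so the subtracted mixed term
    is rewritten as the addition of a negative multiple.\<close>
  have minus: "- (h ^ 3 / 3 * m * w) = (- (h ^ 3 / 3 * m)) * w" for m w by simp
  show ?thesis
    unfolding W_total_def case_prod_beta W_memb_def W_memb_bend_def W_bend_curv_def Let_def
      W_shell_eq_bilin B_def[symmetric] C_def[symmetric] X_def[symmetric]
      diff_conv_add_uminus[of _ "h^3 / 3 * _ * _"] minus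
    by (intro quadratic_form_add quadratic_form_cmult quadratic_form_W_shell_bilin
        quadratic_form_W_mp quadratic_form_W_curv X right bounded_linear_fst bounded_linear_snd)
qed

section \<open>Curvature bounds\<close>

text \<open>Moving along \<open>u\<close>, the increment of \<open>f\<close> over \<open>v\<close>
  has derivative close to \<open>F v u\<close>, because \<open>f'\<close> is close to its
  linearization at \<open>x\<close>; the mean value inequality on the unit interval then gives the
  estimate.\<close>

lemma second_difference_bound:
  fixes f :: "'a::real_normed_vector \<Rightarrow> 'b::real_normed_vector" and f' :: "'a \<Rightarrow> 'a \<Rightarrow>\<^sub>L 'b"
  assumes f: "\<And>y. y \<in> S \<Longrightarrow> (f has_derivative f' y) (at y)"
    and F: "bounded_linear F"
    and ball: "ball x d \<subseteq> S"
    and f': "\<And>y. norm (y - x) < d \<Longrightarrow> norm (f' y - f' x - F (y - x)) \<le> e * norm (y - x)"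
    and e: "e \<ge> 0" and uv: "norm u + norm v < d"
  shows "norm (f (x + u + v) - f (x + u) - f (x + v) + f x - F v u) \<le> 2 * e * (norm u + norm v)\<^sup>2"
proof -
  interpret F: bounded_linear F by fact
  define M where "M = norm u + norm v"
  \<comment> \<open>\<open>\<psi> 1 - \<psi> 0\<close> is exactly the quantity to be
    estimated.\<close>
  define \<psi> where "\<psi> s = f (x + s *\<^sub>R u + v) - f (x + s *\<^sub>R u) - s *\<^sub>R F v u" for s :: real
  have near: "norm (s *\<^sub>R u + v) \<le> M" "norm (s *\<^sub>R u) \<le> M" if s: "s \<in> {0..1}" for s
  proof -
    have su: "norm (s *\<^sub>R u) \<le> norm u" using s mult_left_le_one_le[of "norm u" s] by simp
    then show "norm (s *\<^sub>R u) \<le> M" unfolding M_def using norm_ge_zero[of v] by linarith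
    show "norm (s *\<^sub>R u + v) \<le> M"
      unfolding M_def using norm_triangle_ineq[of "s *\<^sub>R u" v] su by linarith
  qed
  have inS: "x + w \<in> S" if "norm w \<le> M" for w
  proof -
    have "x + w \<in> ball x d" using that uv by (simp add: M_def dist_norm)
    then show ?thesis using ball by blast
  qed
  have d\<psi>: "(\<psi> has_derivative (\<lambda>t. t *\<^sub>R (f' (x + s *\<^sub>R u + v) u - f' (x + s *\<^sub>R u) u - F v u))) (at s within {0..1})"
    if s: "s \<in> {0..1}" for s
  proof -
    have l: "((\<lambda>s. x + s *\<^sub>R u + w) has_derivative (\<lambda>t. t *\<^sub>R u)) (at s)" for w
      by (auto intro!: derivative_eq_intros)
    have m: "x + s *\<^sub>R u + v \<in> S" "x + s *\<^sub>R u + 0 \<in> S"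
      using inS[OF near(1)[OF s]] inS[OF near(2)[OF s]] by (simp_all add: add.assoc)
    have "((\<lambda>s. f (x + s *\<^sub>R u + v)) has_derivative (\<lambda>t. f' (x + s *\<^sub>R u + v) (t *\<^sub>R u))) (at s)"
      by (rule has_derivative_compose[OF l f[OF m(1)]])
    moreover have "((\<lambda>s. f (x + s *\<^sub>R u)) has_derivative (\<lambda>t. f' (x + s *\<^sub>R u) (t *\<^sub>R u))) (at s)"
      using has_derivative_compose[OF l f[OF m(2)]] by (simp only: add_0_right)
    ultimately have "(\<psi> has_derivative (\<lambda>t. f' (x + s *\<^sub>R u + v) (t *\<^sub>R u) - f' (x + s *\<^sub>R u) (t *\<^sub>R u) - t *\<^sub>R F v u)) (at s)"
      unfolding \<psi>_def
      by (intro has_derivative_diff has_derivative_scaleR_left has_derivative_ident)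
    then show ?thesis
      by (rule has_derivative_at_withinI[THEN has_derivative_eq_rhs]) (simp add: blinfun.scaleR_right scaleR_diff_right)
  qed
  have bound: "norm (f' (x + s *\<^sub>R u + v) u - f' (x + s *\<^sub>R u) u - F v u) \<le> 2 * e * M * M"
    if s: "s \<in> {0..1}" for s
  proof -
    \<comment> \<open>In \<open>?A - ?B\<close> the term \<open>f' x\<close> cancels and linearity
      of \<open>F\<close> leaves only \<open>F v\<close>.\<close>
    let ?A = "f' (x + s *\<^sub>R u + v) - f' x - F (s *\<^sub>R u + v)"
    let ?B = "f' (x + s *\<^sub>R u) - f' x - F (s *\<^sub>R u)"
    have A: "norm ?A \<le> e * M"
      using f'[of "x + s *\<^sub>R u + v"] near(1)[OF s] uv mult_left_mono[OF near(1)[OF s] e]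
      by (simp add: M_def add.assoc)
    have B: "norm ?B \<le> e * M"
      using f'[of "x + s *\<^sub>R u"] near(2)[OF s] uv mult_left_mono[OF near(2)[OF s] e]
      by (simp add: M_def)
    have "f' (x + s *\<^sub>R u + v) u - f' (x + s *\<^sub>R u) u - F v u = (?A - ?B) u"
      by (simp add: blinfun.diff_left blinfun.add_left F.add)
    moreover have "norm ((?A - ?B) u) \<le> norm (?A - ?B) * norm u" by (rule norm_blinfun)
    moreover have "norm (?A - ?B) \<le> 2 * e * M"
      using norm_triangle_ineq4[of ?A ?B] A B by simp
    then have "norm (?A - ?B) * norm u \<le> 2 * e * M * M"
      using e by (intro mult_mono) (auto simp: M_def)
    ultimately show ?thesis by simp
  qed
  have "norm (\<psi> 1 - \<psi> 0) \<le> 2 * e * M * M * norm (1 - 0 :: real)"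
  proof (rule differentiable_bound[OF _ d\<psi>])
    fix s :: real assume s: "s \<in> {0..1}"
    show "onorm (\<lambda>t. t *\<^sub>R (f' (x + s *\<^sub>R u + v) u - f' (x + s *\<^sub>R u) u - F v u)) \<le> 2 * e * M * M"
    proof (rule onorm_le)
      fix t :: real
      show "norm (t *\<^sub>R (f' (x + s *\<^sub>R u + v) u - f' (x + s *\<^sub>R u) u - F v u)) \<le> 2 * e * M * M * norm t"
        using mult_left_mono[OF bound[OF s], of "\<bar>t\<bar>"] by (simp add: mult_ac)
    qed
  qed auto
  then show ?thesis
    by (simp add: \<psi>_def M_def power2_eq_square algebra_simps)
qed

text \<open>Both orders of differentiation are read off the symmetric second difference
  \<open>f (x + u + v) - f (x + u) - f (x + v) + f x\<close>.\<close>

lemma second_derivative_symmetric: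
  fixes f :: "'a::real_normed_vector \<Rightarrow> 'b::real_normed_vector" and f' :: "'a \<Rightarrow> 'a \<Rightarrow>\<^sub>L 'b"
  assumes S: "open S" "x \<in> S"
    and f: "\<And>y. y \<in> S \<Longrightarrow> (f has_derivative f' y) (at y)"
    and F: "(f' has_derivative F) (at x)"
  shows "F u v = F v u"
proof -
  interpret F: bounded_linear F using F by (rule has_derivative_bounded_linear)
  define M where "M = norm u + norm v"
  have "norm (F u v - F v u) \<le> 0 + e" if "e > 0" for e
  proof -
    \<comment> \<open>Using \<open>M + 1\<close> instead of \<open>M\<close> avoids a division by
      zero when both increments vanish.\<close>
    define \<epsilon> where "\<epsilon> = e / (4 * (M + 1)\<^sup>2)"
    have M: "M \<ge> 0" by (simp add: M_def)
    then have \<epsilon>: "\<epsilon> > 0" using that by (simp add: \<epsilon>_def)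
    obtain d1 where d1: "d1 > 0" "ball x d1 \<subseteq> S"
      using S openE by blast
    obtain d2 where d2: "d2 > 0"
      "\<And>y. norm (y - x) < d2 \<Longrightarrow> norm (f' y - f' x - F (y - x)) \<le> \<epsilon> * norm (y - x)"
      using F \<epsilon> unfolding has_derivative_at_alt by blast
    define d where "d = min d1 d2"
    \<comment> \<open>Scaling both increments by \<open>t\<close> brings them into the ball; the
      main terms and the error bound all scale with \<open>t * t\<close>, which cancels at the
      end.\<close>
    define t where "t = d / (2 * (M + 1))"
    have t: "t > 0" using d1 d2 M by (simp add: t_def d_def)
    have tM: "norm (t *\<^sub>R u) + norm (t *\<^sub>R v) = t * M"
      using t by (simp add: M_def distrib_left)
    then have tM': "norm (t *\<^sub>R v) + norm (t *\<^sub>R u) = t * M"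
      by simp
    have "t * M < t * (2 * (M + 1))" using t M by simp
    also have "\<dots> = d" using M by (simp add: t_def)
    finally have uv: "norm (t *\<^sub>R u) + norm (t *\<^sub>R v) < d" "norm (t *\<^sub>R v) + norm (t *\<^sub>R u) < d"
      unfolding tM tM' by simp_all
    have b: "ball x d \<subseteq> S" using d1 by (auto simp: d_def)
    have f': "norm (f' y - f' x - F (y - x)) \<le> \<epsilon> * norm (y - x)" if "norm (y - x) < d" for y
      using d2(2) that by (simp add: d_def)
    note sd = second_difference_bound[OF f F.bounded_linear_axioms b f' less_imp_le[OF \<epsilon>]]
    let ?\<Delta> = "f (x + t *\<^sub>R u + t *\<^sub>R v) - f (x + t *\<^sub>R u) - f (x + t *\<^sub>R v) + f x"
    have 1: "norm (?\<Delta> - (t * t) *\<^sub>R F v u) \<le> 2 * \<epsilon> * (t * M)\<^sup>2"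
      using sd[OF _ _ uv(1)] unfolding tM by (simp add: F.scaleR blinfun.scaleR_left blinfun.scaleR_right)
    \<comment> \<open>\<open>?\<Delta>\<close> is unchanged when \<open>u\<close> and
      \<open>v\<close> are swapped, while \<open>F v u\<close> becomes \<open>F u v\<close>.\<close>
    have 2: "norm (?\<Delta> - (t * t) *\<^sub>R F u v) \<le> 2 * \<epsilon> * (t * M)\<^sup>2"
      using sd[OF _ _ uv(2)] unfolding tM'
      by (simp add: F.scaleR blinfun.scaleR_left blinfun.scaleR_right algebra_simps)
    have "(t * t) *\<^sub>R (F u v - F v u) = (?\<Delta> - (t * t) *\<^sub>R F v u) - (?\<Delta> - (t * t) *\<^sub>R F u v)"
      by (simp add: algebra_simps)
    then have "norm ((t * t) *\<^sub>R (F u v - F v u)) \<le> 4 * \<epsilon> * (t * M)\<^sup>2"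
      using norm_triangle_ineq4[of "?\<Delta> - (t * t) *\<^sub>R F v u" "?\<Delta> - (t * t) *\<^sub>R F u v"] 1 2 by simp
    then have "(t * t) * norm (F u v - F v u) \<le> (t * t) * (4 * \<epsilon> * M\<^sup>2)"
      by (simp add: power2_eq_square mult_ac)
    then have "norm (F u v - F v u) \<le> 4 * \<epsilon> * M\<^sup>2"
      using t by simp
    also have "\<dots> \<le> 4 * \<epsilon> * (M + 1)\<^sup>2"
      using M \<epsilon> by (intro mult_left_mono power_mono) auto
    also have "\<dots> = e" using M by (simp add: \<epsilon>_def add_nonneg_eq_0_iff)
    finally show ?thesis by simp
  qed
  then have "norm (F u v - F v u) \<le> 0" by (rule field_le_epsilon)
  then show ?thesis by simp
qed

section \<open>Eigenvalues of two by two matrices\<close>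

lemma matrix_mul_matrix_inv:
  fixes A :: "real^'n^'n"
  assumes "det A \<noteq> 0"
  shows "A ** matrix_inv A = mat 1"
proof -
  have "\<exists>A'. A ** A' = mat 1 \<and> A' ** A = mat 1"
    using assms invertible_det_nz unfolding invertible_def by blast
  then show ?thesis
    unfolding matrix_inv_def by (rule someI2_ex) simp
qed

lemma eigenvalue_2_iff:
  fixes L :: "real^2^2"
  shows "is_eigenvalue L k \<longleftrightarrow> k\<^sup>2 - trace L * k + det L = 0"
proof -
  have "is_eigenvalue L k \<longleftrightarrow> (\<exists>v. v \<noteq> 0 \<and> (L - k *\<^sub>R mat 1) *v v = 0)"
    by (simp add: is_eigenvalue_def matrix_vector_mult_diff_rdistrib scaleR_matrix_vector_assoc[symmetric])
  also have "\<dots> \<longleftrightarrow> \<not> invertible (L - k *\<^sub>R mat 1)"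
    by (simp add: invertible_left_inverse matrix_left_invertible_ker) blast
  also have "\<dots> \<longleftrightarrow> det (L - k *\<^sub>R mat 1) = 0"
    by (simp add: invertible_det_nz)
  also have "det (L - k *\<^sub>R mat 1) = k\<^sup>2 - trace L * k + det L"
    by (simp add: det_2 trace_def sum_2 mat_def power2_eq_square algebra_simps)
  finally show ?thesis .
qed

text \<open>A matrix that is symmetric for the inner product given by the positive definite \<open>I\<close>
  has real eigenvalues.\<close>

lemma trace_det_bound_of_eigenvalue_bound:
  fixes I L :: "real^2^2"
  assumes sym: "transpose I = I" "transpose (I ** L) = I ** L" and pd: "I $ 2 $ 2 > 0" "det I > 0"
    and ev: "\<And>k. is_eigenvalue L k \<Longrightarrow> \<bar>k\<bar> \<le> r"
  shows "\<bar>trace L\<bar> \<le> 2 * r" and "\<bar>det L\<bar> \<le> r\<^sup>2"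
proof -
  define p q s where "p = I $ 1 $ 1" and "q = I $ 1 $ 2" and "s = I $ 2 $ 2"
  define a b c d where "a = L $ 1 $ 1" and "b = L $ 1 $ 2" and "c = L $ 2 $ 1" and "d = L $ 2 $ 2"
  have q': "I $ 2 $ 1 = q" using sym(1) by (simp add: transpose_def vec_eq_iff q_def)
  have "transpose (I ** L) $ 1 $ 2 = (I ** L) $ 1 $ 2" by (simp only: sym(2))
  then have "(I ** L) $ 2 $ 1 = (I ** L) $ 1 $ 2" by (simp only: transpose_def vec_lambda_beta)
  then have e: "s * c = p * b + q * (d - a)"
    by (simp add: matrix_matrix_mult_def sum_2 q' p_def[symmetric] q_def[symmetric] s_def[symmetric]
        a_def[symmetric] b_def[symmetric] c_def[symmetric] d_def[symmetric] algebra_simps)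
  have s: "s > 0" and D: "p * s - q * q > 0"
    using pd by (simp_all add: s_def det_2 q' p_def q_def)
  \<comment> \<open>The discriminant of the characteristic polynomial; its nonnegativity yields real
    eigenvalues.\<close>
  define \<Delta> where "\<Delta> = (trace L)\<^sup>2 - 4 * det L"
  have \<Delta>: "\<Delta> = (a - d)\<^sup>2 + 4 * b * c"
    by (simp add: \<Delta>_def trace_def sum_2 det_2 a_def b_def c_def d_def power2_eq_square algebra_simps)
  \<comment> \<open>One factor \<open>s\<close> lets the symmetry relation \<open>e\<close>
    eliminate \<open>c\<close>; the second one completes the square, leaving a remainder
    proportional to \<open>det I\<close>.\<close>
  have "s * (s * \<Delta>) = (s * (a - d) - 2 * q * b)\<^sup>2 + 4 * b\<^sup>2 * (p * s - q * q)"
  proof -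
    have "s * \<Delta> = s * (a - d)\<^sup>2 + 4 * b * (s * c)" by (simp add: \<Delta> algebra_simps)
    then have "s * (s * \<Delta>) = s * (s * (a - d)\<^sup>2 + 4 * b * (p * b + q * (d - a)))"
      by (simp only: e)
    then show ?thesis by (simp add: power2_eq_square algebra_simps)
  qed
  also have "\<dots> \<ge> 0" using D by simp
  finally have \<Delta>0: "\<Delta> \<ge> 0" using s by (simp add: zero_le_mult_iff)
  define k1 k2 where "k1 = (trace L + sqrt \<Delta>) / 2" and "k2 = (trace L - sqrt \<Delta>) / 2"
  have sq: "sqrt \<Delta> * sqrt \<Delta> = (trace L)\<^sup>2 - 4 * det L" using \<Delta>0 by (simp add: \<Delta>_def)
  have tr: "trace L = k1 + k2" and dt: "det L = k1 * k2"
    using sq by (simp_all add: k1_def k2_def field_simps power2_eq_square)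
  have "is_eigenvalue L k1" "is_eigenvalue L k2"
    unfolding eigenvalue_2_iff tr dt by (simp_all add: power2_eq_square algebra_simps)
  then have k: "\<bar>k1\<bar> \<le> r" "\<bar>k2\<bar> \<le> r" using ev by auto
  show "\<bar>trace L\<bar> \<le> 2 * r" using k by (simp add: tr)
  show "\<bar>det L\<bar> \<le> r\<^sup>2"
    using k unfolding dt abs_mult power2_eq_square by (intro mult_mono) auto
qed

section \<open>Unit normal and fundamental forms of the midsurface\<close>

lemma midsurface_in_shell_domain:
  assumes "h > 0" "x \<in> \<omega>"
  shows "vector [x $ 1, x $ 2, 0] \<in> shell_domain h \<omega>"
proof -
  have "proj2 (vector [x $ 1, x $ 2, 0]) = x" by (simp add: proj2_def vec_eq_iff forall_2)
  then show ?thesis using assms by (simp add: shell_domain_def)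
qed

text \<open>The chain rule for the inverse composed with \<open>f\<close> supplies a left inverse of
  the derivative.\<close>

lemma C1_diffeomorphism_derivative_inj:
  assumes d: "C1_diffeomorphism_on S f" and x: "x \<in> S"
  obtains T where "(f has_derivative T) (at x)" "inj T"
proof -
  have S: "open S" "inj_on f S" "C1_on S f" "C1_on (f ` S) (inv_into S f)"
    using d by (auto simp: C1_diffeomorphism_on_def)
  obtain f' where f': "(f has_derivative blinfun_apply (f' x)) (at x)"
    using S(3) x unfolding C1_on_def by blast
  obtain g' where g': "(inv_into S f has_derivative blinfun_apply (g' (f x))) (at (f x))"
    using S(4) x unfolding C1_on_def by blast
  have "((\<lambda>y. inv_into S f (f y)) has_derivative (\<lambda>v. g' (f x) (f' x v))) (at x)"
    by (rule has_derivative_compose[OF f' g'])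
  then have "((\<lambda>y. y) has_derivative (\<lambda>v. g' (f x) (f' x v))) (at x)"
    by (rule has_derivative_transform_within_open[OF _ S(1) x]) (simp add: S(2))
  then have "(\<lambda>v. g' (f x) (f' x v)) = (\<lambda>v. v)"
    by (rule has_derivative_unique) (rule has_derivative_ident)
  then have "inj (f' x)" by (metis injI)
  then show ?thesis using f' that by blast
qed

text \<open>A nonzero value certifies that the two tangent vectors are linearly independent, since
  normalizing a zero cross product would return 0.\<close>

lemma unit_normal_nonzero:
  assumes d: "C1_diffeomorphism_on (shell_domain h \<omega>) (shell_map y0)" and "h > 0" "x \<in> \<omega>"
  shows "unit_normal y0 x \<noteq> 0"
proof -
  let ?p = "vector [x $ 1, x $ 2, 0] :: real^3" and ?e = "axis 3 1 :: real^3"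
  obtain T where T: "(shell_map y0 has_derivative T) (at ?p)" "inj T"
    using C1_diffeomorphism_derivative_inj[OF d midsurface_in_shell_domain] assms by blast
  have l: "((\<lambda>s. ?p + s *\<^sub>R ?e) has_derivative (\<lambda>s. s *\<^sub>R ?e)) (at 0)"
    by (auto intro!: derivative_eq_intros)
  have A: "((\<lambda>s. shell_map y0 (?p + s *\<^sub>R ?e)) has_derivative (\<lambda>s. T (s *\<^sub>R ?e))) (at 0)"
    by (rule has_derivative_compose[OF l]) (simp add: T)
  have "proj2 (?p + s *\<^sub>R ?e) = x" "(?p + s *\<^sub>R ?e) $ 3 = s" for s
    by (simp_all add: proj2_def vec_eq_iff forall_2 axis_def)
  then have "shell_map y0 (?p + s *\<^sub>R ?e) = y0 x + s *\<^sub>R unit_normal y0 x" for s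
    by (simp only: shell_map_def)
  then have "((\<lambda>s. y0 x + s *\<^sub>R unit_normal y0 x) has_derivative (\<lambda>s. T (s *\<^sub>R ?e))) (at 0)"
    using A by (simp only:)
  moreover have "((\<lambda>s. y0 x + s *\<^sub>R unit_normal y0 x) has_derivative (\<lambda>s. s *\<^sub>R unit_normal y0 x)) (at 0)"
    by (auto intro!: derivative_eq_intros)
  ultimately have "(\<lambda>s. T (s *\<^sub>R ?e)) = (\<lambda>s. s *\<^sub>R unit_normal y0 x)"
    by (rule has_derivative_unique)
  from fun_cong[OF this, of 1] have "T ?e = unit_normal y0 x" by simp
  moreover have "?e \<noteq> 0" by simp
  then have "T ?e \<noteq> T 0" using injD[OF T(2)] by blast
  moreover have "T 0 = 0" using T(1) has_derivative_linear linear_0 by blast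
  ultimately show ?thesis by simp
qed

text \<open>On \<open>S\<close> the normal is a normalized cross product of values of
  \<open>f'\<close>, and normalization is differentiable away from 0.\<close>

lemma unit_normal_differentiable:
  assumes S: "open S" "x \<in> S"
    and f: "\<And>y. y \<in> S \<Longrightarrow> (y0 has_derivative blinfun_apply (f' y)) (at y)"
    and F: "(f' has_derivative F) (at x)" and n: "unit_normal y0 x \<noteq> 0"
  shows "unit_normal y0 differentiable (at x)"
proof -
  define c where "c y = (f' y (axis 1 1)) \<times> (f' y (axis 2 1))" for y
  have col: "column i (jacobian y0 (at y)) = f' y (axis i 1)" if "y \<in> S" for y i
    using frechet_derivative_at[OF f[OF that]]
    by (simp add: jacobian_def column_def matrix_def vec_eq_iff)
  have n_eq: "unit_normal y0 y = c y /\<^sub>R norm (c y)" if "y \<in> S" for y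
    by (simp add: unit_normal_def Let_def col[OF that] c_def)
  have c0: "c x \<noteq> 0" using n n_eq[OF S(2)] by auto
  have d: "((\<lambda>y. f' y u) has_derivative (\<lambda>v. F v u)) (at x)" for u
    by (rule bounded_linear.has_derivative[OF blinfun.bounded_linear_left F])
  have bc: "bounded_bilinear (\<times>)"
    using bilinear_cross by (simp add: bilinear_conv_bounded_bilinear)
  have c: "c differentiable (at x)"
    unfolding c_def using bounded_bilinear.FDERIV[OF bc d d] by (rule differentiableI)
  have "(\<lambda>y. norm (c y)) differentiable (at x)"
    by (rule differentiable_compose[where f = norm, OF differentiable_norm_at[OF c0] c])
  then have "(\<lambda>y. c y /\<^sub>R norm (c y)) differentiable (at x)"
    using c0 c by (intro differentiable_scaleR differentiable_inverse) auto
  then obtain D where "((\<lambda>y. c y /\<^sub>R norm (c y)) has_derivative D) (at x)"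
    unfolding differentiable_def by blast
  then have "(unit_normal y0 has_derivative D) (at x)"
    by (rule has_derivative_transform_within_open[OF _ S]) (simp add: n_eq)
  then show ?thesis by (rule differentiableI)
qed

lemma curvature_bounds:
  assumes \<omega>: "open \<omega>" "x \<in> \<omega>" and y0: "C2_on \<omega> y0"
    and d: "C1_diffeomorphism_on (shell_domain h \<omega>) (shell_map y0)" and h: "h > 0"
    and \<kappa>: "\<And>k. principal_curvature y0 x k \<Longrightarrow> h * \<bar>k\<bar> < 1/2"
  shows "\<bar>gauss_curvature y0 x\<bar> * h\<^sup>2 \<le> 1/4" and "\<bar>mean_curvature y0 x\<bar> * h \<le> 1/2"
proof -
  obtain f' where f': "\<And>y. y \<in> \<omega> \<Longrightarrow> (y0 has_derivative blinfun_apply (f' y)) (at y)" and "C1_on \<omega> f'"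
    using y0 unfolding C2_on_def by blast
  then obtain F where F: "(f' has_derivative F) (at x)"
    using \<omega> unfolding C1_on_def by blast
  have n0: "unit_normal y0 x \<noteq> 0" using unit_normal_nonzero[OF d h \<omega>(2)] .
  define P N where "P = jacobian y0 (at x)" and "N = jacobian (unit_normal y0) (at x)"
  have N: "(unit_normal y0 has_derivative (*v) N) (at x)"
    using unit_normal_differentiable[OF \<omega> f' F n0] by (simp add: N_def jacobian_works)
  have J: "f' y u = jacobian y0 (at y) *v u" if "y \<in> \<omega>" for y u
    using frechet_derivative_at[OF f'[OF that]] has_derivative_linear[OF f'[OF that]]
    by (simp add: jacobian_def matrix_works)
  have orth: "f' y u \<bullet> unit_normal y0 y = 0" if "y \<in> \<omega>" for y u
  proof -
    have "f' y u = u $ 1 *\<^sub>R column 1 (jacobian y0 (at y)) + u $ 2 *\<^sub>R column 2 (jacobian y0 (at y))"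
      unfolding J[OF that] by (simp add: matrix_mult_sum sum_2 scalar_mult_eq_scaleR)
    then show ?thesis
      by (simp add: unit_normal_def Let_def inner_add_left dot_cross_self)
  qed
  have dF: "((\<lambda>y. f' y u) has_derivative (\<lambda>v. F v u)) (at x)" for u
    by (rule bounded_linear.has_derivative[OF blinfun.bounded_linear_left F])
  \<comment> \<open>Differentiating the orthogonality \<open>orth\<close> along \<open>v\<close>
    moves the derivative from the normal to the tangent vector; symmetry of \<open>F\<close> then
    makes the second fundamental form symmetric.\<close>
  have PN: "(P *v u) \<bullet> (N *v v) = - (F v u \<bullet> unit_normal y0 x)" for u v
  proof -
    have "((\<lambda>y. f' y u \<bullet> unit_normal y0 y) has_derivative
        (\<lambda>v. f' x u \<bullet> (N *v v) + F v u \<bullet> unit_normal y0 x)) (at x)"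
      by (rule has_derivative_inner[OF dF N])
    then have "((\<lambda>y. 0) has_derivative (\<lambda>v. f' x u \<bullet> (N *v v) + F v u \<bullet> unit_normal y0 x)) (at x)"
      by (rule has_derivative_transform_within_open[OF _ \<omega>]) (simp add: orth)
    then have "(\<lambda>v. f' x u \<bullet> (N *v v) + F v u \<bullet> unit_normal y0 x) = (\<lambda>v. 0)"
      by (rule has_derivative_unique) (rule has_derivative_const)
    then have "f' x u \<bullet> (N *v v) + F v u \<bullet> unit_normal y0 x = 0" by (rule fun_cong)
    then show ?thesis by (simp add: J[OF \<omega>(2)] P_def)
  qed
  have PN_sym: "(P *v u) \<bullet> (N *v v) = (P *v v) \<bullet> (N *v u)" for u v
    by (simp add: PN second_derivative_symmetric[OF \<omega> f' F, of u v])
  define I where "I = first_form y0 x"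
  have I: "I $ i $ j = column i P \<bullet> column j P" for i j
    by (simp add: I_def first_form_def P_def matrix_mult_transpose_dot_column)
  have II: "second_form y0 x $ i $ j = - (column i P \<bullet> column j N)" for i j
    by (simp add: second_form_def P_def N_def matrix_matrix_mult_def transpose_def column_def inner_vec_def)
  have IIsym: "transpose (second_form y0 x) = second_form y0 x"
    using PN_sym[of "axis _ 1" "axis _ 1"]
    by (simp add: vec_eq_iff transpose_def II matrix_vector_mult_basis)
  have Isym: "transpose I = I" by (simp add: vec_eq_iff transpose_def I inner_commute)
  have cross: "column 1 P \<times> column 2 P \<noteq> 0"
    using n0 by (auto simp: unit_normal_def P_def)
  \<comment> \<open>Lagrange's identity: the Gram determinant of the two columns is the squared norm
    of their cross product.\<close>
  have detI: "det I > 0"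
  proof -
    have "det I = (norm (column 1 P \<times> column 2 P))\<^sup>2"
      by (simp only: power2_norm_eq_inner dot_cross) (simp add: det_2 I)
    then show ?thesis using cross by simp
  qed
  have I22: "I $ 2 $ 2 > 0" using cross by (auto simp: I)
  have L: "I ** weingarten y0 x = second_form y0 x"
    using matrix_mul_matrix_inv[of I] detI
    by (simp add: weingarten_def I_def[symmetric] matrix_mul_assoc)
  have ev: "\<bar>k\<bar> \<le> 1 / (2 * h)" if "is_eigenvalue (weingarten y0 x) k" for k
    using \<kappa>[of k] that h by (simp add: principal_curvature_def field_simps)
  have ILsym: "transpose (I ** weingarten y0 x) = I ** weingarten y0 x"
    by (simp only: L IIsym)
  note b = trace_det_bound_of_eigenvalue_bound[OF Isym ILsym I22 detI ev]
  show "\<bar>gauss_curvature y0 x\<bar> * h\<^sup>2 \<le> 1/4"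
    using b(2) h by (simp add: gauss_curvature_def field_simps power2_eq_square)
  show "\<bar>mean_curvature y0 x\<bar> * h \<le> 1/2"
    using b(1) h by (simp add: mean_curvature_def field_simps)
qed

section \<open>Uniform convexity\<close>

theorem corollary3p2:
  fixes \<omega> :: "(real^2) set" and y0 :: "real^2 \<Rightarrow> real^3"
    and h \<mu> \<mu>c lam Lc b1 b2 b3 :: real
  assumes "open \<omega>" and "connected \<omega>" and "bounded \<omega>" and "lipschitz_boundary \<omega>"
    and "C2_on \<omega> y0"
    and "C1_diffeomorphism_on (shell_domain h \<omega>) (shell_map y0)"
    and "h > 0"
    and "\<And>x k. x \<in> \<omega> \<Longrightarrow> principal_curvature y0 x k \<Longrightarrow> h * \<bar>k\<bar> < 1/2"
    and "\<mu> > 0" and "\<mu>c > 0" and "2 * lam + \<mu> > 0"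
    and "b1 > 0" and "b2 > 0" and "b3 > 0" and "Lc > 0"
  shows "\<exists>a>0. \<forall>x\<in>\<omega>. \<forall>E K H1 H2.
    second_derivative (W_total h \<mu> \<mu>c lam Lc b1 b2 b3 y0 x) (E, K) (H1, H2) (H1, H2)
      \<ge> a * ((norm H1)\<^sup>2 + (norm H2)\<^sup>2)"
proof -
  obtain c1 where c1: "c1 > 0" "\<And>S. c1 * (norm S)\<^sup>2 \<le> W_shell \<mu> \<mu>c lam S"
    using W_shell_coercive[OF assms(9-11)] by blast
  obtain c2 where c2: "c2 > 0" "\<And>S. c2 * (norm S)\<^sup>2 \<le> W_curv \<mu> Lc b1 b2 b3 S"
    using W_curv_coercive[OF assms(9,12-15)] by blast
  have curv_nonneg: "W_curv \<mu> Lc b1 b2 b3 S \<ge> 0" for S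
    using mult_nonneg_nonneg[OF less_imp_le[OF c2(1)] zero_le_power2[of "norm S"]] c2(2)[of S]
    by linarith
  \<comment> \<open>Both entries depend only on \<open>h\<close> and the constitutive coefficients,
    so \<open>c\<close> serves every point of \<open>\<omega>\<close>; the factor 2 below is the one
    between a quadratic form and its second derivative.\<close>
  define c where "c = min (h / 4 * c1) (h / 2 * c2)"
  have "2 * c > 0" using c1 c2 \<open>h > 0\<close> by (simp add: c_def)
  moreover have "second_derivative (W_total h \<mu> \<mu>c lam Lc b1 b2 b3 y0 x) (E, K) (H1, H2) (H1, H2)
      \<ge> 2 * c * ((norm H1)\<^sup>2 + (norm H2)\<^sup>2)" if x: "x \<in> \<omega>" for x E K H1 H2
  proof -
    note K = curvature_bounds(1)[OF assms(1) x assms(5-7) assms(8)[OF x]]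
      and H = curvature_bounds(2)[OF assms(1) x assms(5-7) assms(8)[OF x]]
    have "c * (norm H1)\<^sup>2 \<le> h / 4 * c1 * (norm H1)\<^sup>2" "c * (norm H2)\<^sup>2 \<le> h / 2 * c2 * (norm H2)\<^sup>2"
      by (intro mult_right_mono; simp add: c_def)+
    moreover have "h / 4 * c1 * (norm H1)\<^sup>2 \<le> h / 4 * W_shell \<mu> \<mu>c lam H1"
      "h / 2 * c2 * (norm H2)\<^sup>2 \<le> h / 2 * W_curv \<mu> Lc b1 b2 b3 H2"
      using mult_left_mono[OF c1(2), of "h / 4"] mult_left_mono[OF c2(2), of "h / 2"] \<open>h > 0\<close>
      by (simp_all add: mult.assoc)
    moreover note membrane_energy_ge[OF \<open>h > 0\<close> K H assms(9-11), of H1 H2]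
      bending_energy_ge[OF \<open>h > 0\<close> K curv_nonneg, of H2]
    ultimately have "c * (norm H1)\<^sup>2 + c * (norm H2)\<^sup>2 \<le> W_total h \<mu> \<mu>c lam Lc b1 b2 b3 y0 x (H1, H2)"
      unfolding W_total_def case_prod_conv by linarith
    then show ?thesis
      unfolding second_derivative_quadratic_form[OF quadratic_form_W_total]
      by (simp add: distrib_left)
  qed
  ultimately show ?thesis by blast
qed

end
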